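(* Consider the trading prophets problem with transaction costs $\epsilon_\pi,\epsilon_\sigma\in[0,1)$ in the i.i.d.\ model (defined in the context). The Buy Below Sell Above algorithm is $2$-competitive.
   Context: Trading prophets problem with transaction costs, i.i.d.\ model: let $T\ge1$ be an integer and let $X_1,\dots,X_T$ be i.i.d.\ non-negative real random variables with a known distribution $D$ (let $X\sim D$ denote a generic price). Parameters $\epsilon_\pi,\epsilon_\sigma\in[0,1)$ are given. At each time $i=1,\dots,T$ the price $X_i$ is revealed; a trader holding at most one unit of the stock at any time may buy a unit at price $(1+\epsilon_\pi)X_i+\epsilon_\sigma$ (if not holding) or sell its unit at price $(1-\epsilon_\pi)X_i-\epsilon_\sigma$ (if holding). Both the online trader and the prophet start holding one unit of stock. Profit is total sale revenue minus total purchase cost. An online algorithm decides at time $i$ based only on $D$, the realizations $X_1,\dots,X_i$, and possibly internal randomness; $\mathrm{ALG}$ is its profit. $\mathrm{OPT}$ is the maximum profit achievable under the same rules (same transaction costs, same holding constraint, same initial unit) by an offline prophet knowing all realizations in advance. An algorithm is $\alpha$-competitive if $\mathbb{E}[\mathrm{OPT}]\le\alpha\,\mathbb{E}[\mathrm{ALG}]+c$ for a constant $c$ independent of $T$. Buy Below Sell Above algorithm: let $z_H\ge z_L$ be thresholds with $\Pr[X\ge z_H]=\Pr[X\le z_L]$ and $z_H(1-\epsilon_\pi)-\epsilon_\sigma=z_L(1+\epsilon_\pi)+\epsilon_\sigma$. For each time $i$, after observing $X_i$: if it holds the stock and $X_i\ge z_H$, it sells; if it does not hold the stock and $X_i\le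 z_L$, it buys. *)

theory Defs
  imports "HOL-Probability.Probability"
begin

definition sell_price :: "real \<Rightarrow> real \<Rightarrow> real \<Rightarrow> real" where
  "sell_price eps_pi eps_sigma p = (1 - eps_pi) * p - eps_sigma"

definition buy_price :: "real \<Rightarrow> real \<Rightarrow> real \<Rightarrow> real" where
  "buy_price eps_pi eps_sigma p = (1 + eps_pi) * p + eps_sigma"

text \<open>
  A trader is described by its position \<open>h\<close>: \<open>h i\<close> says whether it holds the unit after time \<open>i\<close>,
  and \<open>h 0\<close> is the initial position. A change of position at time \<open>i\<close> is a sale or a purchase at
  the price \<open>x i\<close>, so every \<open>h\<close> with \<open>h 0\<close> is a legal way to trade from one initial unit,
  and there are no others. A unit still held after time \<open>T\<close> is worth nothing.
\<close>

definition profit :: "real \<Rightarrow> real \<Rightarrow> nat \<Rightarrow> (nat \<Rightarrow> real) \<Rightarrow> (nat \<Rightarrow> bool) \<Rightarrow> real" where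
  "profit eps_pi eps_sigma T x h =
     (\<Sum>i = 1..T. if h (i - 1) \<and> \<not> h i then sell_price eps_pi eps_sigma (x i)
                 else if \<not> h (i - 1) \<and> h i then - buy_price eps_pi eps_sigma (x i)
                 else 0)"

definition opt :: "real \<Rightarrow> real \<Rightarrow> nat \<Rightarrow> (nat \<Rightarrow> real) \<Rightarrow> real" where
  "opt eps_pi eps_sigma T x = Max (profit eps_pi eps_sigma T x ` {h. h 0})"

text \<open>The maximum is over a finite set, since only the positions up to time \<open>T\<close> matter.\<close>

lemma finite_profits: "finite (profit eps_pi eps_sigma T x ` {h. h 0})"
proof -
  have "profit eps_pi eps_sigma T x h = profit eps_pi eps_sigma T x (\<lambda>i. i \<in> {i. i \<le> T \<and> h i})" for h
    unfolding profit_def by (intro sum.cong) auto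
  then have "profit eps_pi eps_sigma T x ` {h. h 0}
      \<subseteq> (\<lambda>A. profit eps_pi eps_sigma T x (\<lambda>i. i \<in> A)) ` Pow {..T}"
    by (intro image_subsetI) (rule image_eqI, assumption, auto)
  then show ?thesis
    by (rule finite_subset) simp
qed

text \<open>
  An algorithm maps a price sequence to the positions it takes. It is online if its position after
  time \<open>i\<close> depends only on the prices at times \<open>1, \<dots>, i\<close>. No random seed is modelled;
  the algorithm defined below is deterministic.
\<close>

definition online_algorithm :: "((nat \<Rightarrow> real) \<Rightarrow> nat \<Rightarrow> bool) \<Rightarrow> bool" where
  "online_algorithm A \<longleftrightarrow>
     (\<forall>x. A x 0) \<and> (\<forall>x y i. (\<forall>j\<in>{1..i}. x j = y j) \<longrightarrow> A x i = A y i)"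

text \<open>
  Expectations take values in the extended reals, because \<open>D\<close> may have infinite mean.
  \<open>has_expectation\<close> rules out the undefined case of infinity minus infinity.
\<close>

definition has_expectation :: "'a measure \<Rightarrow> ('a \<Rightarrow> real) \<Rightarrow> bool" where
  "has_expectation M f \<longleftrightarrow> f \<in> borel_measurable M \<and>
     ((\<integral>\<^sup>+x. ennreal (f x) \<partial>M) \<noteq> \<infinity> \<or> (\<integral>\<^sup>+x. ennreal (- f x) \<partial>M) \<noteq> \<infinity>)"

definition ext_expectation :: "'a measure \<Rightarrow> ('a \<Rightarrow> real) \<Rightarrow> ereal" where
  "ext_expectation M f =
     enn2ereal (\<integral>\<^sup>+x. ennreal (f x) \<partial>M) - enn2ereal (\<integral>\<^sup>+x. ennreal (- f x) \<partial>M)"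

text \<open>
  The i.i.d. prices \<open>X\<^sub>1, \<dots>, X\<^sub>T\<close> with law \<open>D\<close> are the coordinates of the product space
  \<open>D\<^sup>T\<close>. The constant \<open>c\<close> may depend on \<open>D\<close> and on the transaction costs, but not on \<open>T\<close>.
\<close>

definition price_space :: "real measure \<Rightarrow> nat \<Rightarrow> (nat \<Rightarrow> real) measure" where
  "price_space D T = (\<Pi>\<^sub>M i\<in>{1..T}. D)"

definition competitive ::
    "real measure \<Rightarrow> real \<Rightarrow> real \<Rightarrow> real \<Rightarrow> ((nat \<Rightarrow> real) \<Rightarrow> nat \<Rightarrow> bool) \<Rightarrow> bool" where
  "competitive D eps_pi eps_sigma \<alpha> A \<longleftrightarrow>
     online_algorithm A \<and>
     (\<exists>c::real. \<forall>T\<ge>1.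
        has_expectation (price_space D T) (opt eps_pi eps_sigma T) \<and>
        has_expectation (price_space D T) (\<lambda>x. profit eps_pi eps_sigma T x (A x)) \<and>
        ext_expectation (price_space D T) (opt eps_pi eps_sigma T)
          \<le> ereal \<alpha> * ext_expectation (price_space D T) (\<lambda>x. profit eps_pi eps_sigma T x (A x))
             + ereal c)"

primrec buy_below_sell_above :: "real \<Rightarrow> real \<Rightarrow> (nat \<Rightarrow> real) \<Rightarrow> nat \<Rightarrow> bool" where
  "buy_below_sell_above z_L z_H x 0 = True"
| "buy_below_sell_above z_L z_H x (Suc i) =
     (if buy_below_sell_above z_L z_H x i then \<not> x (Suc i) \<ge> z_H else x (Suc i) \<le> z_L)"

end

theory Submission
  imports Defs
begin

text \<open>
  Let \<open>m\<close> be the common value of the sale revenue at \<open>z_H\<close> and the purchase cost at \<open>z_L\<close>.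
  Measured relative to \<open>m\<close>, a sale gains at most \<open>u = (sell price - m)\<^sup>+\<close> and a purchase at most
  \<open>v = (m - buy price)\<^sup>+\<close>, so by telescoping every trader earns at most
  \<open>\<Sum>i. u (x i) + v (x i)\<close> up to an additive \<open>\<bar>m\<bar>\<close>. The threshold rule earns \<open>u (x i)\<close> whenever it
  holds the unit and \<open>v (x i)\<close> whenever it does not. Since it flips its position with the same
  probability \<open>q\<close> from either state, the position \<open>r T = Pr[holding] - Pr[not holding]\<close> satisfies
  \<open>r (T + 1) = (1 - 2 q) r T\<close>. The deviation \<open>(E u - E v) \<Sum>t<T. r t\<close> of twice the expected gain from
  \<open>T (E u + E v)\<close> is therefore \<open>(E u - E v) (1 - r T) / (2 q)\<close>, which is bounded in \<open>T\<close>.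
\<close>

section \<open>Profit relative to a reference price\<close>

definition sell_gain :: "real \<Rightarrow> real \<Rightarrow> real \<Rightarrow> real \<Rightarrow> real" where
  "sell_gain eps_pi eps_sigma m p = max 0 (sell_price eps_pi eps_sigma p - m)"

definition buy_gain :: "real \<Rightarrow> real \<Rightarrow> real \<Rightarrow> real \<Rightarrow> real" where
  "buy_gain eps_pi eps_sigma m p = max 0 (m - buy_price eps_pi eps_sigma p)"

text \<open>Sales and purchases alternate, so their numbers differ by the change of position from
  time 0 to \<open>T\<close>. Charging \<open>m\<close> to every sale and crediting it to every
  purchase therefore shifts the total only by a telescoping boundary term.\<close>

lemma profit_relative:
  "profit e s T x h =
     (\<Sum>i = 1..T. if h (i - 1) \<and> \<not> h i then sell_price e s (x i) - m
                 else if \<not> h (i - 1) \<and> h i then m - buy_price e s (x i) else 0)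
     + m * (of_bool (h 0) - of_bool (h T))"
proof (induction T)
  case 0
  then show ?case by (simp add: profit_def)
next
  case (Suc T)
  have "profit e s (Suc T) x h = profit e s T x h
      + (if h T \<and> \<not> h (Suc T) then sell_price e s (x (Suc T))
         else if \<not> h T \<and> h (Suc T) then - buy_price e s (x (Suc T)) else 0)"
    by (simp add: profit_def)
  with Suc show ?case by (auto simp: algebra_simps)
qed

lemma profit_le_gains:
  assumes "h 0"
  shows "profit e s T x h \<le> (\<Sum>i = 1..T. sell_gain e s m (x i) + buy_gain e s m (x i)) + \<bar>m\<bar>"
  unfolding profit_relative[where m = m]
  by (intro add_mono sum_mono) (auto simp: assms sell_gain_def buy_gain_def)

lemma opt_le_gains:
  "opt e s T x \<le> (\<Sum>i = 1..T. sell_gain e s m (x i) + buy_gain e s m (x i)) + \<bar>m\<bar>"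
  unfolding opt_def using finite_profits[of e s T x]
  by (subst Max_le_iff) (auto simp del: One_nat_def intro!: profit_le_gains)

lemma opt_nonneg: "0 \<le> opt e s T x"
  unfolding opt_def
  by (rule Max_ge[OF finite_profits]) (auto intro!: image_eqI[of _ _ "\<lambda>_. True"] simp: profit_def)

text \<open>Makes the index set of the maximum finite and independent of \<open>x\<close>, which is
  what the measurability of \<open>opt\<close> rests on.\<close>

lemma opt_eq_Max_subsets:
  "opt e s T x = Max ((\<lambda>A. profit e s T x (\<lambda>i. i \<in> A)) ` {A. A \<subseteq> {..T} \<and> 0 \<in> A})"
proof -
  have *: "profit e s T x h = profit e s T x (\<lambda>i. i \<in> {i. i \<le> T \<and> h i})" for h
    unfolding profit_def by (intro sum.cong) auto
  have "profit e s T x ` {h. h 0} = (\<lambda>A. profit e s T x (\<lambda>i. i \<in> A)) ` {A. A \<subseteq> {..T} \<and> 0 \<in> A}"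
  proof (intro equalityI image_subsetI)
    fix h :: "nat \<Rightarrow> bool" assume "h \<in> {h. h 0}"
    then show "profit e s T x h \<in> (\<lambda>A. profit e s T x (\<lambda>i. i \<in> A)) ` {A. A \<subseteq> {..T} \<and> 0 \<in> A}"
      by (intro image_eqI[where x = "{i. i \<le> T \<and> h i}"] *) auto
  qed auto
  then show ?thesis by (simp add: opt_def)
qed

section \<open>Extended expectations\<close>

text \<open>The negative part is bounded by a constant, hence has a finite integral. It serves
  \<open>opt\<close> with \<open>c = 0\<close> and the threshold rule with
  \<open>c = \<bar>m\<bar>\<close>.\<close>

lemma has_expectation_bounded_below:
  assumes "finite_measure M" "f \<in> borel_measurable M" "\<And>x. - c \<le> f x"
  shows "has_expectation M f"
proof -
  interpret finite_measure M by fact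
  have "(\<integral>\<^sup>+x. ennreal (- f x) \<partial>M) \<le> (\<integral>\<^sup>+x. ennreal c \<partial>M)"
    using assms(3) by (intro nn_integral_mono ennreal_leI) (simp add: minus_le_iff)
  also have "\<dots> < \<infinity>"
    by (simp add: ennreal_mult_eq_top_iff less_top[symmetric])
  finally show ?thesis
    using assms(2) by (auto simp: has_expectation_def)
qed

lemma ext_expectation_integrable:
  assumes "integrable M f"
  shows "ext_expectation M f = ereal (integral\<^sup>L M f)"
proof -
  have "(\<integral>\<^sup>+x. ennreal (f x) \<partial>M) \<noteq> \<infinity>" "(\<integral>\<^sup>+x. ennreal (- f x) \<partial>M) \<noteq> \<infinity>"
    using assms by (auto simp: real_integrable_def)
  then obtain a b where ab: "0 \<le> a" "0 \<le> b"
      "(\<integral>\<^sup>+x. ennreal (f x) \<partial>M) = ennreal a" "(\<integral>\<^sup>+x. ennreal (- f x) \<partial>M) = ennreal b"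
    by (metis ennreal_cases infinity_ennreal_def)
  then show ?thesis
    using assms by (simp add: ext_expectation_def real_lebesgue_integral_def enn2ereal_ennreal)
qed

lemma ext_expectation_infinite:
  assumes "has_expectation M f" "(\<integral>\<^sup>+x. ennreal (f x) \<partial>M) = \<infinity>"
  shows "ext_expectation M f = \<infinity>"
  using assms by (cases "\<integral>\<^sup>+x. ennreal (- f x) \<partial>M")
    (auto simp: ext_expectation_def has_expectation_def enn2ereal_ennreal)

section \<open>The threshold rule on i.i.d. prices\<close>

lemma online_buy_below_sell_above: "online_algorithm (buy_below_sell_above z_L z_H)"
proof -
  have "buy_below_sell_above z_L z_H x i = buy_below_sell_above z_L z_H y i"
    if "\<forall>j\<in>{1..i}. x j = y j" for x y :: "nat \<Rightarrow> real" and i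
    using that by (induction i) auto
  then show ?thesis by (auto simp: online_algorithm_def)
qed

locale threshold_market = real_distribution D for D :: "real measure" +
  fixes eps_pi eps_sigma z_L z_H m q :: real
  assumes nonneg: "AE p in D. 0 \<le> p"
    and eps_pi: "0 \<le> eps_pi" "eps_pi < 1"
    and prob_high: "measure D {p. p \<ge> z_H} = q"
    and prob_low: "measure D {p. p \<le> z_L} = q"
    and sell_threshold: "sell_price eps_pi eps_sigma z_H = m"
    and buy_threshold: "buy_price eps_pi eps_sigma z_L = m"
begin

abbreviation "holding \<equiv> buy_below_sell_above z_L z_H"
abbreviation "u \<equiv> sell_gain eps_pi eps_sigma m"
abbreviation "v \<equiv> buy_gain eps_pi eps_sigma m"
abbreviation "P \<equiv> price_space D"

definition gain :: "nat \<Rightarrow> (nat \<Rightarrow> real) \<Rightarrow> real" where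
  "gain T x = (\<Sum>i = 1..T. if holding x (i - 1) then u (x i) else v (x i))"

text \<open>The quantity \<open>r T\<close> of the overview, written as the mean of a sign so that
  its recursion comes from integrating out the last price.\<close>

definition bias :: "nat \<Rightarrow> real" where
  "bias T = (\<integral>x. (if holding x T then 1 else - 1) \<partial>P T)"

sublocale prices: product_prob_space "\<lambda>_::nat. D" UNIV
  by unfold_locales

lemma prob_space_prices: "prob_space (P T)"
  unfolding price_space_def by (intro prob_space_PiM) unfold_locales

text \<open>Since \<open>m\<close> is the sale revenue at \<open>z_H\<close>, the truncation in
  \<open>u\<close> switches exactly where the rule starts to sell.\<close>

lemma sell_gain_eq: "u p = (1 - eps_pi) * max 0 (p - z_H)"
proof -
  have "sell_price eps_pi eps_sigma p - m = (1 - eps_pi) * (p - z_H)"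
    by (simp add: sell_price_def algebra_simps flip: sell_threshold)
  then show ?thesis using eps_pi
    by (simp add: sell_gain_def max_def mult_le_0_iff zero_le_mult_iff)
qed

lemma buy_gain_eq: "v p = (1 + eps_pi) * max 0 (z_L - p)"
proof -
  have "m - buy_price eps_pi eps_sigma p = (1 + eps_pi) * (z_L - p)"
    by (simp add: buy_price_def algebra_simps flip: buy_threshold)
  then show ?thesis using eps_pi
    by (simp add: buy_gain_def max_def mult_le_0_iff zero_le_mult_iff)
qed

lemma gains_nonneg: "0 \<le> u p" "0 \<le> v p"
  by (simp_all add: sell_gain_def buy_gain_def)

lemma gain_nonneg: "0 \<le> gain T x"
  unfolding gain_def by (intro sum_nonneg) (simp add: gains_nonneg)

text \<open>Equality holds because the rule trades exactly when the trade gains at least 0 relative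
  to \<open>m\<close>; otherwise the truncated gain is 0, as is the trade.\<close>

lemma profit_threshold:
  "profit eps_pi eps_sigma T x (holding x) = gain T x + m * (1 - of_bool (holding x T))"
proof -
  have step: "(if holding x j \<and> \<not> holding x (Suc j) then sell_price eps_pi eps_sigma (x (Suc j)) - m
         else if \<not> holding x j \<and> holding x (Suc j) then m - buy_price eps_pi eps_sigma (x (Suc j)) else 0)
       = (if holding x j then u (x (Suc j)) else v (x (Suc j)))" for j
  proof -
    have "sell_price eps_pi eps_sigma (x (Suc j)) - m = (1 - eps_pi) * (x (Suc j) - z_H)"
      by (simp add: sell_price_def algebra_simps flip: sell_threshold)
    moreover have "m - buy_price eps_pi eps_sigma (x (Suc j)) = (1 + eps_pi) * (z_L - x (Suc j))"
      by (simp add: buy_price_def algebra_simps flip: buy_threshold)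
    ultimately show ?thesis
      by (simp add: sell_gain_eq buy_gain_eq max_def)
  qed
  have "(\<Sum>i = 1..T.
        if holding x (i - 1) \<and> \<not> holding x i then sell_price eps_pi eps_sigma (x i) - m
        else if \<not> holding x (i - 1) \<and> holding x i then m - buy_price eps_pi eps_sigma (x i) else 0)
      = gain T x"
    unfolding gain_def
  proof (rule sum.cong)
    fix i assume "i \<in> {1..T}"
    \<comment> \<open>The successor form turns \<open>i - 1\<close> into \<open>j\<close>, so that
      the recursion of the rule unfolds.\<close>
    then obtain j where "i = Suc j" by (cases i) auto
    then show "(if holding x (i - 1) \<and> \<not> holding x i then sell_price eps_pi eps_sigma (x i) - m
        else if \<not> holding x (i - 1) \<and> holding x i then m - buy_price eps_pi eps_sigma (x i) else 0)
      = (if holding x (i - 1) then u (x i) else v (x i))"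
      using step[of j] by (simp only: diff_Suc_1)
  qed simp
  then show ?thesis
    unfolding profit_relative[where m = m] by simp
qed

lemma profit_threshold_ge: "gain T x - \<bar>m\<bar> \<le> profit eps_pi eps_sigma T x (holding x)"
  by (auto simp: profit_threshold)

section \<open>Measurability and existence of expectations\<close>

lemma measurable_price [measurable]:
  "i \<in> {1..T} \<Longrightarrow> (\<lambda>x. x i) \<in> borel_measurable (P T)"
  unfolding price_space_def by measurable

lemma measurable_gains [measurable]: "u \<in> borel_measurable borel" "v \<in> borel_measurable borel"
  unfolding sell_gain_def buy_gain_def sell_price_def buy_price_def by measurable

lemma measurable_holding [measurable]: "i \<le> T \<Longrightarrow> Measurable.pred (P T) (\<lambda>x. holding x i)"
proof (induction i)
  case (Suc i)
  then have [measurable]: "Measurable.pred (P T) (\<lambda>x. holding x i)" by simp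
  have [measurable]: "(\<lambda>x. x (Suc i)) \<in> borel_measurable (P T)"
    using Suc by (intro measurable_price) auto
  show ?case by simp
qed simp

lemma measurable_gain [measurable]: "gain T \<in> borel_measurable (P T)"
proof -
  have "(\<lambda>x. if holding x (i - 1) then u (x i) else v (x i)) \<in> borel_measurable (P T)"
    if "i \<in> {1..T}" for i
  proof -
    have [measurable]: "(\<lambda>x. x i) \<in> borel_measurable (P T)"
      using that by (rule measurable_price)
    have [measurable]: "Measurable.pred (P T) (\<lambda>x. holding x (i - 1))"
      using that by (intro measurable_holding) auto
    show ?thesis by measurable
  qed
  then show ?thesis unfolding gain_def by (intro borel_measurable_sum)
qed

lemma measurable_profit_threshold [measurable]:
  "(\<lambda>x. profit eps_pi eps_sigma T x (holding x)) \<in> borel_measurable (P T)"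
  unfolding profit_threshold by measurable

lemma measurable_opt [measurable]: "opt eps_pi eps_sigma T \<in> borel_measurable (P T)"
proof -
  have "(\<lambda>x. profit eps_pi eps_sigma T x h) \<in> borel_measurable (P T)" for h
    unfolding profit_def sell_price_def buy_price_def
  proof (intro borel_measurable_sum)
    fix i assume "i \<in> {1..T}"
    then have [measurable]: "(\<lambda>x. x i) \<in> borel_measurable (P T)" by (rule measurable_price)
    show "(\<lambda>x. if h (i - 1) \<and> \<not> h i then (1 - eps_pi) * x i - eps_sigma
                 else if \<not> h (i - 1) \<and> h i then - ((1 + eps_pi) * x i + eps_sigma) else 0)
        \<in> borel_measurable (P T)"
      by measurable
  qed
  then show ?thesis
    unfolding opt_eq_Max_subsets[abs_def]
    by (intro borel_measurable_Max) (auto intro: finite_subset[of _ "Pow {..T}"])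
qed

lemma has_expectation_opt: "has_expectation (P T) (opt eps_pi eps_sigma T)"
  using prob_space_prices[of T] opt_nonneg
  by (intro has_expectation_bounded_below[where c = 0]) (auto simp: prob_space_def)

lemma has_expectation_profit:
  "has_expectation (P T) (\<lambda>x. profit eps_pi eps_sigma T x (holding x))"
proof (rule has_expectation_bounded_below[where c = "\<bar>m\<bar>"])
  show "- \<bar>m\<bar> \<le> profit eps_pi eps_sigma T x (holding x)" for x
    using profit_threshold_ge[of T x] gain_nonneg[of T x] by linarith
qed (use prob_space_prices[of T] in \<open>auto simp: prob_space_def\<close>)

section \<open>Marginal laws and integration over the last price\<close>

lemma distr_price:
  assumes "i \<in> {1..T}"
  shows "distr (P T) D (\<lambda>x. x i) = D"
  unfolding price_space_def by (rule distr_PiM_component) (use assms in \<open>auto intro: prob_space_axioms\<close>)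

lemma measurable_price': "i \<in> {1..T} \<Longrightarrow> (\<lambda>x. x i) \<in> measurable (P T) D"
  unfolding price_space_def by measurable

lemma integrable_price:
  fixes f :: "real \<Rightarrow> real"
  assumes "i \<in> {1..T}" "integrable D f"
  shows "integrable (P T) (\<lambda>x. f (x i))"
  by (rule integrable_distr[OF measurable_price'[OF assms(1)]]) (simp only: distr_price[OF assms(1)] assms(2))

lemma integral_price:
  fixes f :: "real \<Rightarrow> real"
  assumes "i \<in> {1..T}" "f \<in> borel_measurable D"
  shows "(\<integral>x. f (x i) \<partial>P T) = (\<integral>p. f p \<partial>D)"
  using integral_distr[OF measurable_price'[OF assms(1)], of f] assms
  by (simp add: distr_price)

lemma nn_integral_price:
  assumes "i \<in> {1..T}" "f \<in> borel_measurable D"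
  shows "(\<integral>\<^sup>+x. f (x i) \<partial>P T) = (\<integral>\<^sup>+p. f p \<partial>D)"
  using nn_integral_distr[OF measurable_price'[OF assms(1)], of f] assms
  by (simp add: distr_price)

text \<open>Fubini for the split of \<open>{1..Suc T}\<close> into \<open>{1..T}\<close> and
  \<open>Suc T\<close>: the inner integral plays the role of conditioning on the first
  \<open>T\<close> prices.\<close>

lemma integral_price_space_Suc:
  fixes f :: "(nat \<Rightarrow> real) \<Rightarrow> real"
  assumes "integrable (P (Suc T)) f"
  shows "(\<integral>x. f x \<partial>P (Suc T)) = (\<integral>x. (\<integral>y. f (x(Suc T := y)) \<partial>D) \<partial>P T)"
  using prices.product_integral_insert[of "{1..T}" "Suc T" f] assms
  by (simp add: price_space_def atLeastAtMostSuc_conv)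

text \<open>Being online makes earlier positions constants in the inner integral over the last
  price.\<close>

lemma holding_update: "i < j \<Longrightarrow> holding (x(j := y)) i = holding x i"
  by (induction i) auto

lemma gain_update: "gain T (x(Suc T := y)) = gain T x"
  unfolding gain_def by (intro sum.cong) (auto simp: holding_update)

text \<open>Nonnegative prices bound \<open>z_L - p\<close> by \<open>\<bar>z_L\<bar>\<close>, so
  only \<open>u\<close> can have infinite mean.\<close>

lemma integrable_buy_gain: "integrable D v"
proof (rule integrable_const_bound[where B = "(1 + eps_pi) * \<bar>z_L\<bar>"])
  show "AE p in D. norm (v p) \<le> (1 + eps_pi) * \<bar>z_L\<bar>"
    using nonneg by eventually_elim (use eps_pi(1) in \<open>auto simp: buy_gain_eq intro!: mult_left_mono\<close>)
qed simp

lemma integrable_position: "i \<le> T \<Longrightarrow> integrable (P T) (\<lambda>x. if holding x i then a else b :: real)"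
proof -
  assume [simp]: "i \<le> T"
  interpret P: prob_space "P T" by (rule prob_space_prices)
  show ?thesis
    by (rule P.integrable_const_bound[where B = "max \<bar>a\<bar> \<bar>b\<bar>"]) auto
qed

section \<open>Recursion for the expected position\<close>

lemma bias_bound: "\<bar>bias T\<bar> \<le> 1"
proof -
  interpret P: prob_space "P T" by (rule prob_space_prices)
  have "\<bar>bias T\<bar> \<le> (\<integral>x. \<bar>if holding x T then 1 else - 1\<bar> \<partial>P T)"
    unfolding bias_def by (rule integral_abs_bound)
  also have "\<dots> = (\<integral>x. 1 \<partial>P T)" by (intro Bochner_Integration.integral_cong) auto
  finally show ?thesis by (simp add: P.prob_space)
qed

lemma bias_Suc: "bias (Suc T) = (1 - 2 * q) * bias T"
proof -
  have high: "(\<integral>y. (if \<not> z_H \<le> y then 1 else - 1 :: real) \<partial>D) = 1 - 2 * q"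
  proof -
    have "(\<integral>y. (if \<not> z_H \<le> y then 1 else - 1 :: real) \<partial>D) = (\<integral>y. 1 - 2 * indicator {p. p \<ge> z_H} y \<partial>D)"
      by (intro Bochner_Integration.integral_cong) (auto simp: indicator_def)
    then show ?thesis using prob_space
      by (simp add: prob_high Bochner_Integration.integral_diff less_top[symmetric])
  qed
  have low: "(\<integral>y. (if y \<le> z_L then 1 else - 1 :: real) \<partial>D) = 2 * q - 1"
  proof -
    have "(\<integral>y. (if y \<le> z_L then 1 else - 1 :: real) \<partial>D) = (\<integral>y. 2 * indicator {p. p \<le> z_L} y - 1 \<partial>D)"
      by (intro Bochner_Integration.integral_cong) (auto simp: indicator_def)
    then show ?thesis using prob_space
      by (simp add: prob_low Bochner_Integration.integral_diff less_top[symmetric])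
  qed
  \<comment> \<open>From either position the mean of the next sign is \<open>1 - 2 * q\<close> times
    the current sign; this is where the two tail probabilities must agree.\<close>
  have step: "(\<integral>y. (if holding (x(Suc T := y)) (Suc T) then 1 else - 1 :: real) \<partial>D)
      = (1 - 2 * q) * (if holding x T then 1 else - 1)" for x
    using high low by (simp add: holding_update if_distrib cong: if_cong)
  show ?thesis
    unfolding bias_def
    by (subst integral_price_space_Suc)
      (auto intro!: integrable_position simp only: step integral_mult_right_zero)
qed

lemma bias_0: "bias 0 = 1"
proof -
  interpret P: prob_space "P 0" by (rule prob_space_prices)
  show ?thesis by (simp add: bias_def P.prob_space)
qed

section \<open>Finite expected sell gain\<close>

context
  assumes integrable_sell_gain: "integrable D u"
begin

lemma integrable_gain: "t \<le> T \<Longrightarrow> integrable (P T) (gain t)"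
proof -
  assume t: "t \<le> T"
  have "integrable (P T) (\<lambda>x. if holding x (i - 1) then u (x i) else v (x i))" if "i \<in> {1..t}" for i
  proof (rule Bochner_Integration.integrable_bound)
    have i: "i \<in> {1..T}" using that t by auto
    show "integrable (P T) (\<lambda>x. u (x i) + v (x i))"
      using i integrable_sell_gain integrable_buy_gain
      by (intro Bochner_Integration.integrable_add integrable_price)
    have [measurable]: "(\<lambda>x. x i) \<in> borel_measurable (P T)"
      using i by (rule measurable_price)
    have [measurable]: "Measurable.pred (P T) (\<lambda>x. holding x (i - 1))"
      using i by (intro measurable_holding) auto
    show "(\<lambda>x. if holding x (i - 1) then u (x i) else v (x i)) \<in> borel_measurable (P T)"
      by measurable
  qed (use gains_nonneg in \<open>auto intro!: AE_I2\<close>)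
  then show ?thesis unfolding gain_def by (intro Bochner_Integration.integrable_sum)
qed

lemma integral_gain_Suc:
  "2 * (\<integral>x. gain (Suc T) x \<partial>P (Suc T))
     = 2 * (\<integral>x. gain T x \<partial>P T) + (expectation u + expectation v)
       + bias T * (expectation u - expectation v)"
proof -
  \<comment> \<open>Chosen so that \<open>?a + ?b * s\<close> is \<open>expectation u\<close> for
    \<open>s = 1\<close> and \<open>expectation v\<close> for \<open>s = - 1\<close>; the choice by
    position becomes affine in the sign and integrates to \<open>bias T\<close>.\<close>
  let ?a = "(expectation u + expectation v) / 2" and ?b = "(expectation u - expectation v) / 2"
  interpret P: prob_space "P T" by (rule prob_space_prices)
  have "(\<integral>y. gain (Suc T) (x(Suc T := y)) \<partial>D) = gain T x + (?a + ?b * (if holding x T then 1 else - 1))"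
    for x
  proof -
    have "(\<integral>y. gain (Suc T) (x(Suc T := y)) \<partial>D) = (\<integral>y. gain T x + (if holding x T then u y else v y) \<partial>D)"
      by (intro Bochner_Integration.integral_cong refl)
        (simp add: gain_def holding_update, intro sum.cong, auto simp: holding_update)
    also have "\<dots> = gain T x + (if holding x T then expectation u else expectation v)"
      using integrable_sell_gain integrable_buy_gain prob_space by simp
    also have "\<dots> = gain T x + (?a + ?b * (if holding x T then 1 else - 1))"
      by (simp add: field_simps)
    finally show ?thesis .
  qed
  then have "(\<integral>x. gain (Suc T) x \<partial>P (Suc T))
      = (\<integral>x. gain T x + (?a + ?b * (if holding x T then 1 else - 1)) \<partial>P T)"
    by (simp add: integral_price_space_Suc integrable_gain)
  also have "\<dots> = (\<integral>x. gain T x \<partial>P T) + (?a + ?b * bias T)"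
    unfolding bias_def
    by (simp add: integrable_gain integrable_position P.prob_space del: integral_mult_right_zero)
  finally show ?thesis by (simp add: field_simps)
qed

text \<open>For \<open>q = 0\<close> both gains vanish almost surely, so the quotient \<open>(E u - E v) / (2 q)\<close> may be any \<open>\<kappa>\<close>.\<close>

lemma gain_difference: "\<exists>\<kappa>. expectation u - expectation v = 2 * q * \<kappa>"
proof (cases "q = 0")
  case True
  have null: "{p. p \<ge> z_H} \<in> null_sets D" "{p. p \<le> z_L} \<in> null_sets D"
    using True prob_high prob_low by (auto simp: null_sets_def emeasure_eq_measure)
  have "AE p in D. u p = 0" "AE p in D. v p = 0"
    using AE_not_in[OF null(1)] AE_not_in[OF null(2)]
    by (eventually_elim, simp add: sell_gain_eq buy_gain_eq)+
  then have "expectation u = 0" "expectation v = 0"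
    by (auto intro: integral_eq_zero_AE)
  then show ?thesis by (auto simp: True)
next
  case False
  then show ?thesis
    by (intro exI[of _ "(expectation u - expectation v) / (2 * q)"]) simp
qed

text \<open>By \<open>bias_Suc\<close>, the term \<open>(1 - bias T) * \<kappa>\<close> grows by
  \<open>2 * q * \<kappa> * bias T\<close> per step, which is the deviation term in
  \<open>integral_gain_Suc\<close>.\<close>

lemma integral_gain:
  assumes "expectation u - expectation v = 2 * q * \<kappa>"
  shows "2 * (\<integral>x. gain T x \<partial>P T) = real T * (expectation u + expectation v) + (1 - bias T) * \<kappa>"
proof (induction T)
  case 0
  then show ?case by (simp add: gain_def bias_0)
next
  case (Suc T)
  then show ?case
    unfolding integral_gain_Suc bias_Suc assms by (simp add: algebra_simps)
qed

lemma competitive_finite_mean: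
  "\<exists>c::real. \<forall>T. ext_expectation (P T) (opt eps_pi eps_sigma T)
     \<le> ereal 2 * ext_expectation (P T) (\<lambda>x. profit eps_pi eps_sigma T x (holding x)) + ereal c"
proof -
  obtain \<kappa> where \<kappa>: "expectation u - expectation v = 2 * q * \<kappa>"
    using gain_difference by blast
  \<comment> \<open>One \<open>\<bar>m\<bar>\<close> comes from the bound on \<open>opt\<close>, two
    from doubling the bound on the profit, and \<open>2 * \<bar>\<kappa>\<bar>\<close> from
    \<open>\<bar>1 - bias T\<bar> \<le> 2\<close>.\<close>
  have "ext_expectation (P T) (opt eps_pi eps_sigma T)
     \<le> ereal 2 * ext_expectation (P T) (\<lambda>x. profit eps_pi eps_sigma T x (holding x))
        + ereal (3 * \<bar>m\<bar> + 2 * \<bar>\<kappa>\<bar>)" for T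
  proof -
    interpret P: prob_space "P T" by (rule prob_space_prices)
    let ?B = "\<lambda>x. (\<Sum>i = 1..T. u (x i) + v (x i)) + \<bar>m\<bar>"
    have int_uv: "integrable (P T) (\<lambda>x. u (x i))" "integrable (P T) (\<lambda>x. v (x i))"
      if "i \<in> {1..T}" for i
      using that by (auto intro: integrable_price integrable_sell_gain integrable_buy_gain)
    then have int_B: "integrable (P T) ?B"
      by (intro Bochner_Integration.integrable_add Bochner_Integration.integrable_sum) auto
    have B: "opt eps_pi eps_sigma T x \<le> ?B x" for x by (rule opt_le_gains)
    \<comment> \<open>\<open>opt\<close> lies between 0 and the integrable
      \<open>?B\<close>.\<close>
    have int_opt: "integrable (P T) (opt eps_pi eps_sigma T)"
      by (rule Bochner_Integration.integrable_bound[OF int_B])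
        (use B opt_nonneg in \<open>auto intro!: AE_I2 order_trans[OF _ abs_ge_self]\<close>)
    have "(\<integral>x. opt eps_pi eps_sigma T x \<partial>P T) \<le> (\<integral>x. ?B x \<partial>P T)"
      using int_opt int_B B by (rule integral_mono)
    also have "(\<integral>x. ?B x \<partial>P T) = (\<Sum>i = 1..T. expectation u + expectation v) + \<bar>m\<bar>"
    proof -
      have "(\<integral>x. ?B x \<partial>P T) = (\<integral>x. (\<Sum>i = 1..T. u (x i) + v (x i)) \<partial>P T) + \<bar>m\<bar>"
        using int_uv
        by (subst Bochner_Integration.integral_add)
          (auto simp: P.prob_space simp del: One_nat_def
            intro!: Bochner_Integration.integrable_add Bochner_Integration.integrable_sum)
      also have "(\<integral>x. (\<Sum>i = 1..T. u (x i) + v (x i)) \<partial>P T)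
          = (\<Sum>i = 1..T. \<integral>x. u (x i) + v (x i) \<partial>P T)"
        using int_uv by (intro Bochner_Integration.integral_sum) auto
      also have "\<dots> = (\<Sum>i = 1..T. expectation u + expectation v)"
        using int_uv
        by (intro sum.cong refl)
          (simp add: integral_price[where f = u] integral_price[where f = v] del: One_nat_def)
      finally show ?thesis .
    qed
    finally have opt: "(\<integral>x. opt eps_pi eps_sigma T x \<partial>P T)
        \<le> real T * (expectation u + expectation v) + \<bar>m\<bar>"
      by simp
    have int_profit: "integrable (P T) (\<lambda>x. profit eps_pi eps_sigma T x (holding x))"
      using integrable_position[of T T m 0]
      by (auto simp: profit_threshold integrable_gain integrable_position of_bool_def)
    have "(\<integral>x. gain T x \<partial>P T) - \<bar>m\<bar> = (\<integral>x. gain T x - \<bar>m\<bar> \<partial>P T)"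
      by (simp add: integrable_gain P.prob_space)
    also have "\<dots> \<le> (\<integral>x. profit eps_pi eps_sigma T x (holding x) \<partial>P T)"
      using int_profit by (intro integral_mono profit_threshold_ge) (auto simp: integrable_gain)
    finally have profit: "2 * (\<integral>x. gain T x \<partial>P T) - 2 * \<bar>m\<bar>
        \<le> 2 * (\<integral>x. profit eps_pi eps_sigma T x (holding x) \<partial>P T)"
      by simp
    have "\<bar>(1 - bias T) * \<kappa>\<bar> \<le> 2 * \<bar>\<kappa>\<bar>"
      unfolding abs_mult using bias_bound[of T] by (intro mult_right_mono) auto
    then have "(\<integral>x. opt eps_pi eps_sigma T x \<partial>P T)
        \<le> 2 * (\<integral>x. profit eps_pi eps_sigma T x (holding x) \<partial>P T) + (3 * \<bar>m\<bar> + 2 * \<bar>\<kappa>\<bar>)"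
      using opt profit integral_gain[OF \<kappa>, of T] by linarith
    then show ?thesis
      by (simp add: ext_expectation_integrable int_opt int_profit)
  qed
  then show ?thesis by blast
qed

end

section \<open>Infinite expected sell gain\<close>

text \<open>The initial unit alone already brings in \<open>u (x 1)\<close>.\<close>

lemma profit_infinite_mean:
  assumes "\<not> integrable D u" "T \<ge> 1"
  shows "ext_expectation (P T) (\<lambda>x. profit eps_pi eps_sigma T x (holding x)) = \<infinity>"
proof (rule ext_expectation_infinite[OF has_expectation_profit])
  interpret P: prob_space "P T" by (rule prob_space_prices)
  have T: "1 \<in> {1..T}" using assms(2) by simp
  \<comment> \<open>\<open>ennreal\<close> maps negative reals to 0, so additivity can fail for
    \<open>a < 0\<close>, but this direction survives.\<close>
  have plus: "ennreal (a + \<bar>m\<bar>) \<le> ennreal a + ennreal \<bar>m\<bar>" for a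
    by (cases "0 \<le> a") (auto simp: ennreal_neg intro!: ennreal_leI)
  have le: "u (x 1) \<le> profit eps_pi eps_sigma T x (holding x) + \<bar>m\<bar>" for x
  proof -
    have "u (x 1) = (\<Sum>i\<in>{1}. if holding x (i - 1) then u (x i) else v (x i))" by simp
    also have "\<dots> \<le> gain T x"
      unfolding gain_def using T by (intro sum_mono2) (auto simp: gains_nonneg)
    finally show ?thesis using profit_threshold_ge[of T x] by linarith
  qed
  have "\<infinity> = (\<integral>\<^sup>+p. ennreal (u p) \<partial>D)"
    using assms(1) by (auto simp: integrable_iff_bounded gains_nonneg less_top[symmetric])
  also have "\<dots> = (\<integral>\<^sup>+x. ennreal (u (x 1)) \<partial>P T)"
    using T by (subst nn_integral_price[where f = "\<lambda>p. ennreal (u p)"]) auto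
  also have "\<dots> \<le> (\<integral>\<^sup>+x. ennreal (profit eps_pi eps_sigma T x (holding x)) + ennreal \<bar>m\<bar> \<partial>P T)"
    by (intro nn_integral_mono order_trans[OF ennreal_leI[OF le]]) (rule plus)
  also have "\<dots> = (\<integral>\<^sup>+x. ennreal (profit eps_pi eps_sigma T x (holding x)) \<partial>P T) + ennreal \<bar>m\<bar>"
    by (subst nn_integral_add) (auto simp: P.emeasure_space_1)
  finally show "(\<integral>\<^sup>+x. ennreal (profit eps_pi eps_sigma T x (holding x)) \<partial>P T) = \<infinity>"
    by (auto simp: top_unique)
qed

lemma competitive: "competitive D eps_pi eps_sigma 2 holding"
proof -
  have "\<exists>c::real. \<forall>T\<ge>1. ext_expectation (P T) (opt eps_pi eps_sigma T)
     \<le> ereal 2 * ext_expectation (P T) (\<lambda>x. profit eps_pi eps_sigma T x (holding x)) + ereal c"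
  proof (cases "integrable D u")
    case True
    then show ?thesis using competitive_finite_mean by blast
  next
    case False
    \<comment> \<open>For \<open>T \<ge> 1\<close> the right-hand side is infinite, so any
      \<open>c\<close> works.\<close>
    then show ?thesis by (auto simp: profit_infinite_mean)
  qed
  then show ?thesis
    unfolding competitive_def
    using online_buy_below_sell_above has_expectation_opt has_expectation_profit by blast
qed

end

theorem theorem2:
  fixes D :: "real measure" and eps_pi eps_sigma z_L z_H :: real
  assumes "real_distribution D"
    and "AE p in D. 0 \<le> p"
    and "0 \<le> eps_pi" "eps_pi < 1" "0 \<le> eps_sigma" "eps_sigma < 1"
    and "z_L \<le> z_H"
    and "measure D {p. p \<ge> z_H} = measure D {p. p \<le> z_L}"
    and "z_H * (1 - eps_pi) - eps_sigma = z_L * (1 + eps_pi) + eps_sigma"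
  shows "competitive D eps_pi eps_sigma 2 (buy_below_sell_above z_L z_H)"
proof -
  interpret real_distribution D by fact
  \<comment> \<open>With \<open>m\<close> and \<open>q\<close> read off at \<open>z_H\<close>, the
    two balance conditions on the thresholds supply \<open>buy_threshold\<close> and
    \<open>prob_low\<close>.\<close>
  interpret threshold_market D eps_pi eps_sigma z_L z_H
      "sell_price eps_pi eps_sigma z_H" "measure D {p. p \<ge> z_H}"
    by unfold_locales (use assms in \<open>auto simp: sell_price_def buy_price_def mult.commute\<close>)
  show ?thesis by (rule competitive)
qed

end
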